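(* Let $X^{\mathrm{in}}\subset\mathbb R^d$ be a nonempty polytope with $X^{\mathrm{in}}\neq\{0\}$, let $A$ be a real $d\times d$ matrix with spectral radius $\rho(A)<1$ admitting a decomposition $A=UDU^{-1}$ with $U$ a non-singular complex matrix and $D$ a complex diagonal matrix, let $Q$ be a real symmetric $d\times d$ matrix with $\lambda_{\max}(Q)\neq 0$ that is either positive semi-definite or negative definite, and let $q\in\mathbb R^d$, with $q\neq0$ if $Q$ is negative definite. Let $N\in\mathbb N$ be fixed and let $\nu_k$ and the algorithm $\mathcal A$ be as defined in the context. Suppose that $\inf\{k\in\mathbb N\mid\nu_k>0\}\le N$ (in particular some $\nu_k$ is positive). Then the algorithm $\mathcal A$ returns the optimal value and a pair of maximizers for the problem $\sup_{k\in\mathbb N}\sup_{x\in X^{\mathrm{in}}}f_k(x)$; that is, it terminates and returns a triple $(\nu_{\rm opt},x_{\rm opt},k_{\rm opt})$ with $(k_{\rm opt},x_{\rm opt})\in\mathbb N\times X^{\mathrm{in}}$ and $f_{k_{\rm opt}}(x_{\rm opt})=\nu_{\rm opt}=\sup_{k\in\mathbb N}\nu_k$.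
   Context: $\mathbb N=\{0,1,2,\dots\}$. A polytope is the convex hull of finitely many points. $U^*$ is the conjugate transpose; $\lambda_{\max}(B)$ is the greatest eigenvalue of a Hermitian matrix $B$. The problem is to maximize $x^\intercal Qx+q^\intercal x$ over the reachable values set $\bigcup_{k\in\mathbb N}A^k(X^{\mathrm{in}})$ of the linear system $x_{k+1}=Ax_k$, $x_0\in X^{\mathrm{in}}$. Put $f_k(x)=x^\intercal (A^k)^\intercal QA^kx+q^\intercal A^kx$ and $\nu_k=\sup_{x\in X^{\mathrm{in}}}f_k(x)$ for $k\in\mathbb N$. For a Hermitian matrix $B$, $\mu(B)=\sup_{x\in X^{\mathrm{in}}}x^\intercal Bx$. $V_{\rm diag}=\dfrac{\|U^*q\|_2}{2\sqrt{|\lambda_{\max}(U^*QU)|}}$ (here $\lambda_{\max}(U^*QU)\neq0$ because $\lambda_{\max}(Q)\neq0$). For $j$ with $\nu_j>0$, $$\mathbf K^{\rm diag}_\nu(j)=\left\lfloor\frac{\ln\left(\left(\sqrt{\nu_j+V_{\rm diag}^2}-V_{\rm diag}\right)\left(\sqrt{|\lambda_{\max}(U^*QU)|\,\mu\left((UU^* )^{-1}\right)}\right)^{-1}\right)}{\ln(\rho(A))}\right\rfloor+1,$$ with, in the degenerate case $\rho(A)=0$, the convention $\ln 0=-\infty$ and $c/(-\infty)=0$ for real $c$, so that $\mathbf K^{\rm diag}_\nu(j)=1$. Oracle: SolveQP$(f_k,X^{\mathrm{in}})$ returns $(\nu_k,x_k)$ with $x_k\in X^{\mathrm{in}}$ and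 $f_k(x_k)=\nu_k=\max_{x\in X^{\mathrm{in}}}f_k(x)$ (exact). Algorithm $\mathcal A$ (inputs $Q,q,A,X^{\mathrm{in}},N$): (a) Compute $\mu((UU^* )^{-1})$, $V_{\rm diag}$ and $(\nu_0,x_0)=$ SolveQP$(f_0,X^{\mathrm{in}})$. (b) If $\nu_0\ge\left(\sqrt{|\lambda_{\max}(U^*QU)|\,\mu((UU^* )^{-1})}+V_{\rm diag}\right)^2-V_{\rm diag}^2$, return $(\nu_0,x_0,0)$. (c) Otherwise set $k=0$; while $k<N$ and $\nu_k\le0$: set $k=k+1$ and $(\nu_k,x_k)=$ SolveQP$(f_k,X^{\mathrm{in}})$. (d) If $k=N$ and $\nu_k\le0$, return "failed". (e) Otherwise set $K=\mathbf K^{\rm diag}_\nu(k)$, $\nu_{\rm opt}=\nu_k$, $x_{\rm opt}=x_k$, $k_{\rm opt}=k$. While $k<K$: set $k=k+1$ and $(\nu_k,x_k)=$ SolveQP$(f_k,X^{\mathrm{in}})$; if $\nu_{\rm opt}<\nu_k$, set $\nu_{\rm opt}=\nu_k$, $x_{\rm opt}=x_k$, $k_{\rm opt}=k$ and $K=\mathbf K^{\rm diag}_\nu(k)$. (f) Return $(\nu_{\rm opt},x_{\rm opt},k_{\rm opt})$. *)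

theory Defs
  imports
    "HOL-Analysis.Analysis"
    "HOL-Library.Extended_Nat"
    "HOL-Library.While_Combinator"
begin

(* The type class operations on vec, and hence ^ on square matrices, act componentwise. *)
primrec matpow :: "'a::semiring_1 ^ 'n ^ 'n \<Rightarrow> nat \<Rightarrow> 'a ^ 'n ^ 'n" where
  "matpow A 0 = mat 1"
| "matpow A (Suc k) = A ** matpow A k"

definition cvec :: "real ^ 'n \<Rightarrow> complex ^ 'n" where
  "cvec x = (\<chi> i. complex_of_real (x $ i))"

definition cmat :: "real ^ 'n ^ 'n \<Rightarrow> complex ^ 'n ^ 'n" where
  "cmat A = map_matrix complex_of_real A"

definition conj_transpose :: "complex ^ 'n ^ 'm \<Rightarrow> complex ^ 'm ^ 'n" where
  "conj_transpose U = map_matrix cnj (transpose U)"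

definition diagonal_matrix :: "'a::zero ^ 'n ^ 'n \<Rightarrow> bool" where
  "diagonal_matrix D \<longleftrightarrow> (\<forall>i j. i \<noteq> j \<longrightarrow> D $ i $ j = 0)"

definition is_eigenvalue :: "complex ^ 'n ^ 'n \<Rightarrow> complex \<Rightarrow> bool" where
  "is_eigenvalue B c \<longleftrightarrow> (\<exists>v. v \<noteq> 0 \<and> B *v v = c *s v)"

definition spec_radius :: "complex ^ 'n ^ 'n \<Rightarrow> real" where
  "spec_radius B = Max {cmod c |c. is_eigenvalue B c}"

(* Only meaningful for Hermitian B, all of whose eigenvalues are real. *)
definition lambda_max :: "complex ^ 'n ^ 'n \<Rightarrow> real" where
  "lambda_max B = Max {r. is_eigenvalue B (complex_of_real r)}"

definition pos_semidef :: "real ^ 'n ^ 'n \<Rightarrow> bool" where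
  "pos_semidef Q \<longleftrightarrow> (\<forall>x. 0 \<le> x \<bullet> (Q *v x))"

definition neg_def :: "real ^ 'n ^ 'n \<Rightarrow> bool" where
  "neg_def Q \<longleftrightarrow> (\<forall>x. x \<noteq> 0 \<longrightarrow> x \<bullet> (Q *v x) < 0)"

definition fobj :: "real ^ 'n ^ 'n \<Rightarrow> real ^ 'n \<Rightarrow> real ^ 'n ^ 'n \<Rightarrow> nat \<Rightarrow> real ^ 'n \<Rightarrow> real" where
  "fobj Q q A k x =
     x \<bullet> ((transpose (matpow A k) ** Q ** matpow A k) *v x) + q \<bullet> (matpow A k *v x)"

definition nu :: "real ^ 'n ^ 'n \<Rightarrow> real ^ 'n \<Rightarrow> real ^ 'n ^ 'n \<Rightarrow> (real ^ 'n) set \<Rightarrow> nat \<Rightarrow> real" where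
  "nu Q q A X k = (SUP x\<in>X. fobj Q q A k x)"

(* For Hermitian B and real x the number x^T B x is real, so Re only changes the type. *)
definition mu :: "(real ^ 'n) set \<Rightarrow> complex ^ 'n ^ 'n \<Rightarrow> real" where
  "mu X B = (SUP x\<in>X. Re (\<Sum>i\<in>UNIV. cvec x $ i * (B *v cvec x) $ i))"

definition lmaxU :: "complex ^ 'n ^ 'n \<Rightarrow> real ^ 'n ^ 'n \<Rightarrow> real" where
  "lmaxU U Q = lambda_max (conj_transpose U ** cmat Q ** U)"

definition muU :: "complex ^ 'n ^ 'n \<Rightarrow> (real ^ 'n) set \<Rightarrow> real" where
  "muU U X = mu X (matrix_inv (U ** conj_transpose U))"

definition V_diag :: "complex ^ 'n ^ 'n \<Rightarrow> real ^ 'n ^ 'n \<Rightarrow> real ^ 'n \<Rightarrow> real" where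
  "V_diag U Q q = norm (conj_transpose U *v cvec q) / (2 * sqrt \<bar>lmaxU U Q\<bar>)"

(* K_diag at index j depends on j only through the value v = nu_j > 0. *)
definition K_diag :: "complex ^ 'n ^ 'n \<Rightarrow> real ^ 'n ^ 'n \<Rightarrow> real ^ 'n \<Rightarrow> real ^ 'n ^ 'n
    \<Rightarrow> (real ^ 'n) set \<Rightarrow> real \<Rightarrow> int" where
  "K_diag U Q q A X v =
     (if spec_radius (cmat A) = 0 then 1
      else \<lfloor>ln ((sqrt (v + (V_diag U Q q)\<^sup>2) - V_diag U Q q)
                 * inverse (sqrt (\<bar>lmaxU U Q\<bar> * muU U X)))
             / ln (spec_radius (cmat A))\<rfloor> + 1)"

(* Exactness is only demanded on the instances f_k over X. *)
definition exact_oracle :: "real ^ 'n ^ 'n \<Rightarrow> real ^ 'n \<Rightarrow> real ^ 'n ^ 'n \<Rightarrow> (real ^ 'n) set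
    \<Rightarrow> ((real ^ 'n \<Rightarrow> real) \<Rightarrow> (real ^ 'n) set \<Rightarrow> real \<times> (real ^ 'n)) \<Rightarrow> bool" where
  "exact_oracle Q q A X solveQP \<longleftrightarrow>
     (\<forall>k. case solveQP (fobj Q q A k) X of (v, x) \<Rightarrow>
        x \<in> X \<and> fobj Q q A k x = v \<and> v = nu Q q A X k \<and> (\<forall>y\<in>X. fobj Q q A k y \<le> v))"

datatype 'x outcome = Failed | Returned real 'x nat

(* The result None means non-termination of one of the two loops.
   State of the first loop: (k, nu_k, x_k).
   State of the second loop: (k, K, nu_opt, x_opt, k_opt). *)
definition algo :: "((real ^ 'n \<Rightarrow> real) \<Rightarrow> (real ^ 'n) set \<Rightarrow> real \<times> (real ^ 'n))
    \<Rightarrow> complex ^ 'n ^ 'n \<Rightarrow> real ^ 'n ^ 'n \<Rightarrow> real ^ 'n \<Rightarrow> real ^ 'n ^ 'n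
    \<Rightarrow> (real ^ 'n) set \<Rightarrow> nat \<Rightarrow> (real ^ 'n) outcome option" where
  "algo solveQP U Q q A X N =
     (let V = V_diag U Q q;
          (v0, x0) = solveQP (fobj Q q A 0) X
      in if v0 \<ge> (sqrt (\<bar>lmaxU U Q\<bar> * muU U X) + V)\<^sup>2 - V\<^sup>2
         then Some (Returned v0 x0 0)
         else Option.bind
           (while_option (\<lambda>(k, v, x). k < N \<and> v \<le> 0)
              (\<lambda>(k, v, x). (Suc k, solveQP (fobj Q q A (Suc k)) X))
              (0, v0, x0))
           (\<lambda>(k, v, x).
              if k = N \<and> v \<le> 0 then Some Failed
              else map_option (\<lambda>(k, K, vopt, xopt, kopt). Returned vopt xopt kopt)
                (while_option (\<lambda>(k, K, vopt, xopt, kopt). int k < K)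
                   (\<lambda>(k, K, vopt, xopt, kopt).
                      let k' = Suc k; (v', x') = solveQP (fobj Q q A k') X
                      in if vopt < v' then (k', K_diag U Q q A X v', v', x', k')
                         else (k', K, vopt, xopt, kopt))
                   (k, K_diag U Q q A X v, v, x, k))))"

end

theory Submission
  imports Defs
begin

text \<open>
  In the coordinates \<open>y = U\<^sup>-\<^sup>1 x\<close> the dynamics is diagonal, so the Euclidean norm of \<open>y\<close> shrinks by
  the factor \<open>\<rho> = \<rho>(A)\<close> at every step (\<open>norm_trajectory_le\<close>), starting from at most
  \<open>\<surd>\<mu>((U U\<^sup>*)\<^sup>-\<^sup>1)\<close> on \<open>X\<close> (\<open>muU_bounds\<close>). In these coordinates the quadratic part of the objective
  has the Hermitian matrix \<open>U\<^sup>* Q U\<close>, which the Rayleigh quotient bounds by its greatest eigenvalue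
  \<open>\<lambda>\<close> (\<open>hermitian_lambda_max\<close>), and Cauchy--Schwarz bounds the linear part by
  \<open>\<parallel>U\<^sup>* q\<parallel> \<parallel>y\<parallel> = 2 V \<surd>\<bar>\<lambda>\<bar> \<parallel>y\<parallel>\<close>. Completing the square gives, with \<open>L = \<surd>(\<bar>\<lambda>\<bar> \<mu>)\<close>, the envelope
  \<open>\<nu>\<^sub>k \<le> (L \<rho>\<^sup>k + V)\<^sup>2 - V\<^sup>2\<close> (\<open>fobj_le_geometric\<close>), which decreases to \<open>0\<close>.

  Everything else follows from this envelope. At \<open>k = 0\<close> it is the threshold of the initial test, so
  passing that test makes \<open>\<nu>\<^sub>0\<close> optimal. For a value \<open>v > 0\<close> already attained, solving
  \<open>(L \<rho>\<^sup>k + V)\<^sup>2 - V\<^sup>2 \<le> v\<close> for \<open>k\<close> shows that no index from \<open>K(v)\<close> on can beat \<open>v\<close>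
  (\<open>K_diag_sound\<close>). Raising \<open>v\<close> can only lower \<open>K(v)\<close> (\<open>K_diag_antimono\<close>), so the second loop
  terminates, and when it stops, the best value seen dominates both the indices examined and all
  later ones (\<open>improvement_loop\<close>).

  The real inner product of \<open>complex ^ 'n\<close>, which is the real part of the Hermitian one, is used
  throughout: Hermitian matrices are self-adjoint for it, and the values needed of their forms
  are real.
\<close>

section \<open>Self-adjoint operators and the greatest eigenvalue of a Hermitian matrix\<close>

text \<open>
  The Rayleigh quotient attains its maximum on the compact unit sphere, and a point where it does is
  a critical point, hence an eigenvector for the maximal value.
\<close>
lemma selfadjoint_rayleigh_eigenvalue:
  fixes T :: "'a::euclidean_space \<Rightarrow> 'a"
  assumes lin: "linear T" and sa: "\<And>x y. T x \<bullet> y = x \<bullet> T y"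
  obtains r v where "v \<noteq> 0" "T v = r *\<^sub>R v" "\<And>y. y \<bullet> T y \<le> r * (norm y)\<^sup>2"
proof -
  have "continuous_on (sphere 0 1) (\<lambda>y. y \<bullet> T y)"
    using lin by (intro continuous_intros linear_continuous_on linear_conv_bounded_linear[THEN iffD1])
  moreover have "sphere (0::'a) 1 \<noteq> {}" by simp
  ultimately obtain v where v: "v \<in> sphere 0 1" and
      vmax: "\<And>y. y \<in> sphere 0 1 \<Longrightarrow> y \<bullet> T y \<le> v \<bullet> T v"
    using continuous_attains_sup[of "sphere (0::'a) 1" "\<lambda>y. y \<bullet> T y"] compact_sphere by blast
  define r where "r = v \<bullet> T v"
  have bound: "y \<bullet> T y \<le> r * (norm y)\<^sup>2" for y
  proof (cases "y = 0")
    case True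
    then show ?thesis using linear_0[OF lin] by simp
  next
    case False
    let ?u = "y /\<^sub>R norm y"
    have "?u \<bullet> T ?u \<le> r"
      unfolding r_def using False by (intro vmax) simp
    moreover have "?u \<bullet> T ?u = (y \<bullet> T y) / (norm y)\<^sup>2"
      by (simp add: linear_scale[OF lin] power2_eq_square field_simps)
    ultimately have "(y \<bullet> T y) / (norm y)\<^sup>2 \<le> r" by metis
    then show ?thesis using False by (simp add: divide_le_eq)
  qed
  define w where "w = r *\<^sub>R v - T v"
  define b where "b = r * (norm w)\<^sup>2 - w \<bullet> T w"
  have vv: "v \<bullet> v = 1" using v by (simp add: norm_eq_sqrt_inner)
  have b: "0 \<le> b" using bound[of w] by (simp add: b_def)
  (* The nonnegative function r |y|^2 - y . T y vanishes at v, so its derivative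
     at v in the direction w, which is 2 |w|^2, has to vanish. *)
  have quad: "0 \<le> 2 * t * (norm w)\<^sup>2 + t\<^sup>2 * b" for t
  proof -
    have "0 \<le> r * (norm (v + t *\<^sub>R w))\<^sup>2 - (v + t *\<^sub>R w) \<bullet> T (v + t *\<^sub>R w)"
      using bound[of "v + t *\<^sub>R w"] by simp
    also have "\<dots> = 2 * t * (r * (v \<bullet> w) - w \<bullet> T v) + t\<^sup>2 * b"
    proof -
      have n: "(norm (v + t *\<^sub>R w))\<^sup>2 = 1 + 2 * t * (v \<bullet> w) + t\<^sup>2 * (norm w)\<^sup>2"
        unfolding power2_norm_eq_inner
        using vv by (simp add: inner_add_left inner_add_right inner_commute
            algebra_simps power2_eq_square)
      have q: "(v + t *\<^sub>R w) \<bullet> T (v + t *\<^sub>R w) = r + 2 * t * (w \<bullet> T v) + t\<^sup>2 * (w \<bullet> T w)"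
        using sa[of v w]
        by (simp add: linear_add[OF lin] linear_scale[OF lin] inner_add_left inner_add_right
            r_def inner_commute algebra_simps power2_eq_square)
      show ?thesis unfolding n q b_def by (simp add: algebra_simps)
    qed
    also have "r * (v \<bullet> w) - w \<bullet> T v = (norm w)\<^sup>2"
      using vv by (simp add: power2_norm_eq_inner w_def inner_diff_left inner_diff_right
          inner_commute algebra_simps)
    finally show ?thesis .
  qed
  have "(norm w)\<^sup>2 \<le> 0"
  proof (cases "b = 0")
    case True
    then show ?thesis using quad[of "-1"] by simp
  next
    case False
    with b have "b > 0" by simp
    define n where "n = (norm w)\<^sup>2"
    (* The quadratic in t takes its minimum at t = - n / b. *)
    have "2 * (- n / b) * n + (- n / b)\<^sup>2 * b = - (n\<^sup>2 / b)"
      using \<open>b > 0\<close> by (simp add: power2_eq_square)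
    then have "n\<^sup>2 / b \<le> 0" using quad[of "- n / b"] by (simp add: n_def)
    then have "n\<^sup>2 \<le> 0" using \<open>b > 0\<close> by (simp add: divide_le_eq)
    then show ?thesis by (simp add: n_def)
  qed
  then have "w = 0" by simp
  then have "T v = r *\<^sub>R v" by (simp add: w_def)
  moreover have "v \<noteq> 0" using vv by auto
  ultimately show ?thesis using bound that by blast
qed

text \<open>
  Eigenvectors for different eigenvalues are orthogonal, and a Euclidean space has room for only
  finitely many of those. Finiteness is what gives the maximum in the definition of
  \<^const>\<open>lambda_max\<close> its meaning.
\<close>
lemma selfadjoint_finite_eigenvalues:
  fixes T :: "'a::euclidean_space \<Rightarrow> 'a"
  assumes sa: "\<And>x y. T x \<bullet> y = x \<bullet> T y"
  shows "finite {r. \<exists>v. v \<noteq> 0 \<and> T v = r *\<^sub>R v}"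
proof -
  define S where "S = {r. \<exists>v. v \<noteq> 0 \<and> T v = r *\<^sub>R v}"
  have "\<forall>r\<in>S. \<exists>v. v \<noteq> 0 \<and> T v = r *\<^sub>R v" by (simp add: S_def)
  from bchoice[OF this] obtain g where g: "\<And>r. r \<in> S \<Longrightarrow> g r \<noteq> 0 \<and> T (g r) = r *\<^sub>R g r"
    by blast
  have orth: "g r \<bullet> g s = 0" if "r \<in> S" "s \<in> S" "r \<noteq> s" for r s
    using sa[of "g r" "g s"] g[OF that(1)] g[OF that(2)] that(3) by simp
  have inj: "inj_on g S"
  proof (rule inj_onI, rule ccontr)
    fix r s assume "r \<in> S" "s \<in> S" "g r = g s" "r \<noteq> s"
    then show False using orth[of r s] g[of s] by simp
  qed
  have "pairwise orthogonal (g ` S)"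
    unfolding pairwise_def orthogonal_def using orth by blast
  moreover have "0 \<notin> g ` S" using g by force
  ultimately have "finite (g ` S)"
    by (intro independent_imp_finite pairwise_orthogonal_independent)
  then show ?thesis using inj finite_image_iff unfolding S_def by blast
qed

lemma inner_conj_transpose:
  fixes M :: "complex ^ 'n ^ 'm"
  shows "(M *v x) \<bullet> y = x \<bullet> (conj_transpose M *v y)"
proof -
  have c: "(a * b) \<bullet> c = b \<bullet> (cnj a * c)" for a b c :: complex
    by (simp add: inner_complex_def algebra_simps)
  have "(M *v x) \<bullet> y = (\<Sum>i\<in>UNIV. \<Sum>j\<in>UNIV. x $ j \<bullet> (cnj (M $ i $ j) * y $ i))"
    by (simp add: inner_vec_def matrix_vector_mult_def inner_sum_left c)
  also have "\<dots> = (\<Sum>j\<in>UNIV. \<Sum>i\<in>UNIV. x $ j \<bullet> (cnj (M $ i $ j) * y $ i))"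
    by (rule sum.swap)
  also have "\<dots> = x \<bullet> (conj_transpose M *v y)"
    by (simp add: inner_vec_def matrix_vector_mult_def inner_sum_right conj_transpose_def
        map_matrix_def transpose_def)
  finally show ?thesis .
qed

lemma conj_transpose_mult:
  fixes M :: "complex ^ 'n ^ 'm" and N :: "complex ^ 'k ^ 'n"
  shows "conj_transpose (M ** N) = conj_transpose N ** conj_transpose M"
  by (simp add: conj_transpose_def map_matrix_def transpose_def matrix_matrix_mult_def
      vec_eq_iff mult.commute)

lemma conj_transpose_conj_transpose: "conj_transpose (conj_transpose M) = M"
  by (simp add: conj_transpose_def map_matrix_def transpose_def vec_eq_iff)

lemma conj_transpose_one: "conj_transpose (mat 1) = mat 1"
  by (simp add: conj_transpose_def map_matrix_def transpose_def vec_eq_iff mat_def)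

lemma conj_transpose_cmat: "conj_transpose (cmat M) = cmat (transpose M)"
  by (simp add: conj_transpose_def cmat_def map_matrix_def transpose_def vec_eq_iff)

lemma of_real_vector_scaleR: "complex_of_real r *s v = r *\<^sub>R v"
  by (simp add: vec_eq_iff scaleR_conv_of_real[symmetric])

lemma linear_complex_matrix: "linear ((*v) (M :: complex ^ 'n ^ 'm))"
  by (rule linearI)
    (simp_all add: matrix_vector_right_distrib vector_scalar_commute
      flip: of_real_vector_scaleR)

lemma hermitian_lambda_max:
  fixes B :: "complex ^ 'n ^ 'n"
  assumes "conj_transpose B = B"
  shows "\<exists>v. v \<noteq> 0 \<and> B *v v = lambda_max B *\<^sub>R v"
    and "y \<bullet> (B *v y) \<le> lambda_max B * (norm y)\<^sup>2"
proof -
  have sa: "(B *v x) \<bullet> y = x \<bullet> (B *v y)" for x y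
    using inner_conj_transpose[of B x y] assms by simp
  obtain r v where v: "v \<noteq> 0" "B *v v = r *\<^sub>R v"
      and bound: "\<And>y. y \<bullet> (B *v y) \<le> r * (norm y)\<^sup>2"
    using selfadjoint_rayleigh_eigenvalue[OF linear_complex_matrix sa] by metis
  have eig: "is_eigenvalue B (complex_of_real s) \<longleftrightarrow> (\<exists>v. v \<noteq> 0 \<and> B *v v = s *\<^sub>R v)" for s
    by (simp add: is_eigenvalue_def of_real_vector_scaleR)
  have "lambda_max B = r"
    unfolding lambda_max_def eig
  proof (rule Max_eqI)
    show "finite {s. \<exists>v. v \<noteq> 0 \<and> B *v v = s *\<^sub>R v}"
      by (rule selfadjoint_finite_eigenvalues[OF sa])
    show "r \<in> {s. \<exists>v. v \<noteq> 0 \<and> B *v v = s *\<^sub>R v}" using v by blast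
    fix s assume "s \<in> {s. \<exists>v. v \<noteq> 0 \<and> B *v v = s *\<^sub>R v}"
    then obtain u where "u \<noteq> 0" "B *v u = s *\<^sub>R u" by blast
    then show "s \<le> r" using bound[of u] by (simp add: power2_norm_eq_inner)
  qed
  with v bound show "\<exists>v. v \<noteq> 0 \<and> B *v v = lambda_max B *\<^sub>R v"
    and "y \<bullet> (B *v y) \<le> lambda_max B * (norm y)\<^sup>2" by auto
qed

lemma hermitian_lambda_max_attained:
  fixes B :: "complex ^ 'n ^ 'n"
  assumes "conj_transpose B = B"
  obtains v where "v \<noteq> 0" "v \<bullet> (B *v v) = lambda_max B * (norm v)\<^sup>2"
proof -
  obtain v where "v \<noteq> 0" "B *v v = lambda_max B *\<^sub>R v"
    using hermitian_lambda_max(1)[OF assms] by blast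
  then show ?thesis using that by (simp add: power2_norm_eq_inner)
qed

section \<open>Complexification and the congruence by the diagonalizing matrix\<close>

lemma cvec_matrix_mult: "cvec (M *v x) = cmat M *v cvec x"
  by (simp add: cvec_def cmat_def map_matrix_def matrix_vector_mult_def vec_eq_iff)

lemma inner_cvec: "cvec x \<bullet> cvec y = x \<bullet> y"
  by (simp add: cvec_def inner_vec_def inner_complex_def)

lemma cvec_eq_0_iff: "cvec x = 0 \<longleftrightarrow> x = 0"
  by (simp add: cvec_def vec_eq_iff)

lemma cmat_quadratic_form:
  fixes M :: "real ^ 'n ^ 'n" and z :: "complex ^ 'n"
  defines "a \<equiv> (\<chi> i. Re (z $ i))" and "b \<equiv> (\<chi> i. Im (z $ i))"
  shows "z \<bullet> (cmat M *v z) = a \<bullet> (M *v a) + b \<bullet> (M *v b)"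
  by (simp add: a_def b_def cmat_def map_matrix_def inner_vec_def inner_complex_def
      matrix_vector_mult_def sum.distrib)

lemma matrix_inv_invertible:
  assumes "invertible M"
  shows "M ** matrix_inv M = mat 1" and "matrix_inv M ** M = mat 1"
  using someI_ex[OF assms[unfolded invertible_def]] by (simp_all add: matrix_inv_def)

lemma congruence_quadratic_form:
  fixes U :: "complex ^ 'n ^ 'n"
  shows "y \<bullet> ((conj_transpose U ** B ** U) *v y) = (U *v y) \<bullet> (B *v (U *v y))"
  by (simp add: inner_conj_transpose flip: matrix_vector_mul_assoc)

lemma conj_transpose_congruence:
  assumes "transpose Q = Q"
  shows "conj_transpose (conj_transpose U ** cmat Q ** U) = conj_transpose U ** cmat Q ** U"
  by (simp add: conj_transpose_mult conj_transpose_conj_transpose conj_transpose_cmat assms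
      matrix_mul_assoc)

text \<open>
  By Sylvester's law the congruence \<open>Q \<mapsto> U\<^sup>* Q U\<close> preserves the sign of a semi-definite or definite
  form. If \<open>Q\<close> is positive semi-definite, a vector on which its form is positive is transported by
  \<open>U\<^sup>-\<^sup>1\<close>; if \<open>Q\<close> is negative definite, so is \<open>U\<^sup>* Q U\<close>, and its top eigenvalue is negative.
\<close>
lemma lmaxU_nonzero:
  fixes U :: "complex ^ 'n ^ 'n"
  assumes U: "invertible U" and Q: "transpose Q = Q" "lambda_max (cmat Q) \<noteq> 0"
    and def: "pos_semidef Q \<or> neg_def Q"
  shows "lmaxU U Q \<noteq> 0"
proof -
  let ?B = "conj_transpose U ** cmat Q ** U"
  have herm: "conj_transpose ?B = ?B" by (rule conj_transpose_congruence[OF Q(1)])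
  show ?thesis using def
  proof
    assume psd: "pos_semidef Q"
    obtain v where v: "v \<noteq> 0" "v \<bullet> (cmat Q *v v) = lambda_max (cmat Q) * (norm v)\<^sup>2"
      using hermitian_lambda_max_attained[of "cmat Q"] Q(1) by (metis conj_transpose_cmat)
    have "0 \<le> v \<bullet> (cmat Q *v v)"
      using psd by (simp add: cmat_quadratic_form pos_semidef_def)
    moreover have "v \<bullet> (cmat Q *v v) \<noteq> 0" using v Q(2) by simp
    ultimately have "0 < v \<bullet> (cmat Q *v v)" by simp
    also have "v = U *v (matrix_inv U *v v)"
      by (simp add: matrix_vector_mul_assoc matrix_inv_invertible[OF U])
    finally have "0 < (matrix_inv U *v v) \<bullet> (?B *v (matrix_inv U *v v))"
      by (simp only: congruence_quadratic_form)
    also have "\<dots> \<le> lmaxU U Q * (norm (matrix_inv U *v v))\<^sup>2"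
      unfolding lmaxU_def by (rule hermitian_lambda_max(2)[OF herm])
    finally show ?thesis by auto
  next
    assume nd: "neg_def Q"
    obtain v where v: "v \<noteq> 0" "v \<bullet> (?B *v v) = lmaxU U Q * (norm v)\<^sup>2"
      using hermitian_lambda_max_attained[OF herm] unfolding lmaxU_def by blast
    have "matrix_inv U *v (U *v v) = v"
      by (simp add: matrix_vector_mul_assoc matrix_inv_invertible[OF U])
    then have "U *v v \<noteq> 0" using v(1) by (metis matrix_vector_mult_0_right)
    define a b where "a = (\<chi> i. Re ((U *v v) $ i))" and "b = (\<chi> i. Im ((U *v v) $ i))"
    have "a \<noteq> 0 \<or> b \<noteq> 0"
      using \<open>U *v v \<noteq> 0\<close> by (auto simp: a_def b_def vec_eq_iff complex_eq_iff)
    moreover have "a \<bullet> (Q *v a) \<le> 0" "b \<bullet> (Q *v b) \<le> 0"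
      using nd unfolding neg_def_def by (metis inner_zero_left less_eq_real_def)+
    ultimately have "a \<bullet> (Q *v a) + b \<bullet> (Q *v b) < 0"
      using nd unfolding neg_def_def by (metis add_neg_nonpos add_nonpos_neg)
    then have "v \<bullet> (?B *v v) < 0"
      unfolding congruence_quadratic_form cmat_quadratic_form a_def b_def .
    then show ?thesis using v(2) by auto
  qed
qed

text \<open>
  Since \<open>(U U\<^sup>*)\<^sup>-\<^sup>1 = (U\<^sup>-\<^sup>1)\<^sup>* U\<^sup>-\<^sup>1\<close>, its form is the squared norm in the diagonalizing
  coordinates.
\<close>
lemma muU_eq_norm:
  fixes U :: "complex ^ 'n ^ 'n"
  assumes U: "invertible U"
  shows "muU U X = (SUP x\<in>X. (norm (matrix_inv U *v cvec x))\<^sup>2)"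
proof -
  let ?W = "matrix_inv U" and ?P = "U ** conj_transpose U"
  have "conj_transpose U ** conj_transpose ?W = mat 1" "conj_transpose ?W ** conj_transpose U = mat 1"
    using matrix_inv_invertible[OF U] by (metis conj_transpose_mult conj_transpose_one)+
  then have "invertible (conj_transpose U)" unfolding invertible_def by blast
  then have P: "invertible ?P" using U by (rule invertible_mult[rotated])
  have "Re (\<Sum>i\<in>UNIV. cvec x $ i * (matrix_inv ?P *v cvec x) $ i) = (norm (?W *v cvec x))\<^sup>2" for x
  proof -
    let ?z = "matrix_inv ?P *v cvec x"
    have "U *v (conj_transpose U *v ?z) = cvec x"
      by (simp only: matrix_vector_mul_assoc matrix_mul_assoc matrix_inv_invertible(1)[OF P]
          matrix_vector_mul_lid)
    then have z: "conj_transpose U *v ?z = ?W *v cvec x"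
      by (metis U matrix_inv_invertible(2) matrix_vector_mul_assoc matrix_vector_mul_lid)
    have "Re (\<Sum>i\<in>UNIV. cvec x $ i * ?z $ i) = cvec x \<bullet> ?z"
      by (simp add: inner_vec_def inner_complex_def cvec_def)
    also have "\<dots> = (U *v (?W *v cvec x)) \<bullet> ?z"
      by (simp add: matrix_vector_mul_assoc matrix_inv_invertible[OF U])
    also have "\<dots> = (norm (?W *v cvec x))\<^sup>2"
      by (simp only: inner_conj_transpose z power2_norm_eq_inner)
    finally show ?thesis .
  qed
  then show ?thesis by (simp add: muU_def mu_def)
qed

lemma muU_bounds:
  fixes U :: "complex ^ 'n ^ 'n"
  assumes U: "invertible U" and X: "compact X" "X \<noteq> {}" "X \<noteq> {0}"
  shows "x \<in> X \<Longrightarrow> norm (matrix_inv U *v cvec x) \<le> sqrt (muU U X)" and "0 < muU U X"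
proof -
  let ?g = "\<lambda>x. (norm (matrix_inv U *v cvec x))\<^sup>2"
  have "linear (\<lambda>x. matrix_inv U *v cvec x)"
    by (rule linear_compose[OF _ linear_complex_matrix, unfolded o_def])
      (rule linearI; simp add: cvec_def vec_eq_iff complex_eq_iff)
  then have "continuous_on X ?g"
    by (intro continuous_intros linear_continuous_on linear_conv_bounded_linear[THEN iffD1])
  then have bdd: "bdd_above (?g ` X)"
    using X(1) by (intro bounded_imp_bdd_above compact_imp_bounded compact_continuous_image)
  have le: "?g x \<le> muU U X" if "x \<in> X" for x
    unfolding muU_eq_norm[OF U] using that bdd by (rule cSUP_upper)
  show "norm (matrix_inv U *v cvec x) \<le> sqrt (muU U X)" if "x \<in> X"
    using le[OF that] by (simp add: real_le_rsqrt)
  obtain x where x: "x \<in> X" "x \<noteq> 0" using X(2,3) by blast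
  have "U *v (matrix_inv U *v cvec x) = cvec x"
    by (simp add: matrix_vector_mul_assoc matrix_inv_invertible[OF U])
  then have "matrix_inv U *v cvec x \<noteq> 0"
    using x(2) by (metis cvec_eq_0_iff matrix_vector_mult_0_right)
  then show "0 < muU U X" using le[OF x(1)] by (smt (verit) zero_less_power2 norm_eq_zero)
qed

section \<open>Geometric decay of the objectives\<close>

lemma diagonal_matrix_mult_nth:
  assumes "diagonal_matrix D"
  shows "(D *v y) $ i = D $ i $ i * y $ i"
proof -
  have "(D *v y) $ i = (\<Sum>j\<in>UNIV. if j = i then D $ i $ i * y $ i else 0)"
    using assms unfolding matrix_vector_mult_def diagonal_matrix_def vec_lambda_beta
    by (intro sum.cong) auto
  then show ?thesis by simp
qed

text \<open>
  Identifying the spectrum with the finite, nonempty set of diagonal entries makes the maximum in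
  the definition of \<^const>\<open>spec_radius\<close> meaningful.
\<close>
lemma diagonalizable_eigenvalues:
  fixes U D B :: "complex ^ 'n ^ 'n"
  assumes U: "invertible U" and D: "diagonal_matrix D" and B: "B = U ** D ** matrix_inv U"
  shows "{c. is_eigenvalue B c} = range (\<lambda>i. D $ i $ i)"
proof (intro equalityI subsetI)
  fix c assume "c \<in> {c. is_eigenvalue B c}"
  then obtain v where v: "v \<noteq> 0" "B *v v = c *s v" by (auto simp: is_eigenvalue_def)
  let ?y = "matrix_inv U *v v"
  have "D *v ?y = matrix_inv U *v (B *v v)"
    by (simp add: B matrix_vector_mul_assoc matrix_mul_assoc matrix_inv_invertible[OF U])
  also have "\<dots> = c *s ?y" by (simp add: v(2) vector_scalar_commute)
  finally have *: "D *v ?y = c *s ?y" .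
  have "U *v ?y = v" by (simp add: matrix_vector_mul_assoc matrix_inv_invertible[OF U])
  then have "?y \<noteq> 0" using v(1) by (metis matrix_vector_mult_0_right)
  then obtain i where "?y $ i \<noteq> 0" by (auto simp: vec_eq_iff)
  moreover have "D $ i $ i * ?y $ i = c * ?y $ i"
    using arg_cong[OF *, of "\<lambda>z. z $ i"] by (simp add: diagonal_matrix_mult_nth[OF D])
  ultimately show "c \<in> range (\<lambda>i. D $ i $ i)" by auto
next
  fix c assume "c \<in> range (\<lambda>i. D $ i $ i)"
  then obtain i where c: "c = D $ i $ i" by blast
  let ?e = "axis i (1::complex)"
  have De: "D *v ?e = c *s ?e"
    by (simp add: vec_eq_iff diagonal_matrix_mult_nth[OF D] c axis_def)
  have We: "matrix_inv U *v (U *v ?e) = ?e"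
    by (simp only: matrix_vector_mul_assoc matrix_inv_invertible[OF U] matrix_vector_mul_lid)
  have "B *v (U *v ?e) = U *v (D *v (matrix_inv U *v (U *v ?e)))"
    by (simp only: B matrix_vector_mul_assoc matrix_mul_assoc)
  also have "\<dots> = c *s (U *v ?e)" by (simp only: We De vector_scalar_commute)
  finally have "B *v (U *v ?e) = c *s (U *v ?e)" .
  moreover have "?e \<noteq> 0" by (simp add: axis_eq_0_iff)
  then have "U *v ?e \<noteq> 0" using We by (metis matrix_vector_mult_0_right)
  ultimately show "c \<in> {c. is_eigenvalue B c}" by (auto simp: is_eigenvalue_def)
qed

lemma diagonalizable_spec_radius:
  fixes U D B :: "complex ^ 'n ^ 'n"
  assumes "invertible U" "diagonal_matrix D" "B = U ** D ** matrix_inv U"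
  shows "cmod (D $ i $ i) \<le> spec_radius B" and "0 \<le> spec_radius B"
proof -
  have "{cmod c |c. is_eigenvalue B c} = range (\<lambda>i. cmod (D $ i $ i))"
    using diagonalizable_eigenvalues[OF assms] by (auto simp: set_eq_iff image_iff)
  then have *: "cmod (D $ i $ i) \<le> spec_radius B" for i
    unfolding spec_radius_def by (auto intro: Max_ge)
  then show "cmod (D $ i $ i) \<le> spec_radius B" .
  show "0 \<le> spec_radius B" using *[of undefined] norm_ge_zero order_trans by blast
qed

lemma norm_diagonal_matrix_mult_le:
  fixes D :: "complex ^ 'n ^ 'n"
  assumes D: "diagonal_matrix D" and \<rho>: "\<And>i. cmod (D $ i $ i) \<le> \<rho>" "0 \<le> \<rho>"
  shows "norm (D *v y) \<le> \<rho> * norm y"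
proof -
  have "norm (D *v y) \<le> norm (\<rho> *\<^sub>R y)"
    by (rule norm_le_componentwise_cart)
      (simp add: diagonal_matrix_mult_nth[OF D] norm_mult \<rho> mult_right_mono)
  then show ?thesis using \<rho>(2) by simp
qed

text \<open>
  The norm is taken after \<open>U\<^sup>-\<^sup>1\<close> because there \<open>A\<close> acts as \<open>D\<close>, whose operator norm is exactly the
  spectral radius; in the original norm a constant depending on \<open>U\<close> would appear.
\<close>
lemma norm_trajectory_le:
  fixes A :: "real ^ 'n ^ 'n" and U D :: "complex ^ 'n ^ 'n"
  assumes U: "invertible U" and D: "diagonal_matrix D" and A: "cmat A = U ** D ** matrix_inv U"
  shows "norm (matrix_inv U *v cvec (matpow A k *v x))
    \<le> spec_radius (cmat A) ^ k * norm (matrix_inv U *v cvec x)"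
proof (induction k)
  case 0
  then show ?case by simp
next
  case (Suc k)
  let ?z = "matpow A k *v x"
  have "matrix_inv U *v cvec (matpow A (Suc k) *v x) = matrix_inv U *v (cmat A *v cvec ?z)"
    by (simp add: cvec_matrix_mult flip: matrix_vector_mul_assoc)
  also have "\<dots> = D *v (matrix_inv U *v cvec ?z)"
    by (simp add: A matrix_vector_mul_assoc matrix_mul_assoc matrix_inv_invertible[OF U])
  finally have "norm (matrix_inv U *v cvec (matpow A (Suc k) *v x))
      \<le> spec_radius (cmat A) * norm (matrix_inv U *v cvec ?z)"
    using norm_diagonal_matrix_mult_le[OF D] diagonalizable_spec_radius[OF U D A] by simp
  also have "\<dots> \<le> spec_radius (cmat A) * (spec_radius (cmat A) ^ k * norm (matrix_inv U *v cvec x))"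
    using Suc diagonalizable_spec_radius(2)[OF U D A] by (rule mult_left_mono)
  finally show ?case by (simp add: mult.assoc)
qed

lemma fobj_at_state:
  "fobj Q q A k x = (matpow A k *v x) \<bullet> (Q *v (matpow A k *v x)) + q \<bullet> (matpow A k *v x)"
proof -
  have "x \<bullet> (transpose M *v w) = (M *v x) \<bullet> w" for M :: "real ^ 'a ^ 'a" and w
    by (metis dot_lmul_matrix inner_commute transpose_matrix_vector)
  then show ?thesis by (simp add: fobj_def flip: matrix_vector_mul_assoc)
qed

lemma V_diag_nonneg: "0 \<le> V_diag U Q q"
  by (simp add: V_diag_def)

text \<open>
  Rayleigh bounds the quadratic part and Cauchy--Schwarz the linear part; \<^const>\<open>V_diag\<close> is the
  constant that completes the square. Replacing \<open>\<lambda>\<close> by \<open>\<bar>\<lambda>\<bar>\<close> treats both signs of \<open>\<lambda>\<close> at once, at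
  the price of a weaker bound when \<open>Q\<close> is negative definite.
\<close>
lemma quadratic_objective_le:
  fixes U :: "complex ^ 'n ^ 'n"
  assumes U: "invertible U" and Q: "transpose Q = Q" and l: "lmaxU U Q \<noteq> 0"
  shows "z \<bullet> (Q *v z) + q \<bullet> z
    \<le> (sqrt \<bar>lmaxU U Q\<bar> * norm (matrix_inv U *v cvec z) + V_diag U Q q)\<^sup>2 - (V_diag U Q q)\<^sup>2"
proof -
  let ?y = "matrix_inv U *v cvec z" and ?l = "\<bar>lmaxU U Q\<bar>" and ?V = "V_diag U Q q"
  have z: "cvec z = U *v ?y"
    by (simp add: matrix_vector_mul_assoc matrix_inv_invertible[OF U])
  have "z \<bullet> (Q *v z) = (U *v ?y) \<bullet> (cmat Q *v (U *v ?y))"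
    by (metis z cvec_matrix_mult inner_cvec)
  also have "\<dots> = ?y \<bullet> ((conj_transpose U ** cmat Q ** U) *v ?y)"
    by (simp only: congruence_quadratic_form)
  also have "\<dots> \<le> lmaxU U Q * (norm ?y)\<^sup>2"
    unfolding lmaxU_def by (rule hermitian_lambda_max(2)[OF conj_transpose_congruence[OF Q]])
  also have "\<dots> \<le> ?l * (norm ?y)\<^sup>2" by (simp add: mult_right_mono)
  finally have 1: "z \<bullet> (Q *v z) \<le> ?l * (norm ?y)\<^sup>2" .
  have "q \<bullet> z = ?y \<bullet> (conj_transpose U *v cvec q)"
    by (metis z inner_cvec inner_commute inner_conj_transpose)
  also have "\<dots> \<le> norm ?y * norm (conj_transpose U *v cvec q)" by (rule norm_cauchy_schwarz)
  also have "norm (conj_transpose U *v cvec q) = 2 * sqrt ?l * ?V"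
    using l by (simp add: V_diag_def)
  finally have 2: "q \<bullet> z \<le> 2 * (sqrt ?l * norm ?y) * ?V" by (simp add: mult_ac)
  show ?thesis using 1 2 by (simp add: power2_sum power_mult_distrib)
qed

lemma fobj_le_geometric:
  fixes A Q :: "real ^ 'n ^ 'n" and U D :: "complex ^ 'n ^ 'n"
  assumes X: "compact X" "X \<noteq> {}" "X \<noteq> {0}"
    and U: "invertible U" and D: "diagonal_matrix D" and A: "cmat A = U ** D ** matrix_inv U"
    and Q: "transpose Q = Q" and l: "lmaxU U Q \<noteq> 0" and x: "x \<in> X"
  shows "fobj Q q A k x
    \<le> (sqrt (\<bar>lmaxU U Q\<bar> * muU U X) * spec_radius (cmat A) ^ k + V_diag U Q q)\<^sup>2 - (V_diag U Q q)\<^sup>2"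
proof -
  let ?\<rho> = "spec_radius (cmat A)" and ?V = "V_diag U Q q"
  let ?y = "matrix_inv U *v cvec (matpow A k *v x)"
  have \<rho>: "0 \<le> ?\<rho>" by (rule diagonalizable_spec_radius(2)[OF U D A])
  have "norm ?y \<le> ?\<rho> ^ k * norm (matrix_inv U *v cvec x)" by (rule norm_trajectory_le[OF U D A])
  also have "\<dots> \<le> ?\<rho> ^ k * sqrt (muU U X)"
    using muU_bounds(1)[OF U X x] \<rho> by (simp add: mult_left_mono)
  finally have "sqrt \<bar>lmaxU U Q\<bar> * norm ?y \<le> sqrt \<bar>lmaxU U Q\<bar> * (?\<rho> ^ k * sqrt (muU U X))"
    by (simp add: mult_left_mono)
  also have "\<dots> = sqrt (\<bar>lmaxU U Q\<bar> * muU U X) * ?\<rho> ^ k"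
    by (simp add: real_sqrt_mult mult_ac)
  finally have "(sqrt \<bar>lmaxU U Q\<bar> * norm ?y + ?V)\<^sup>2
      \<le> (sqrt (\<bar>lmaxU U Q\<bar> * muU U X) * ?\<rho> ^ k + ?V)\<^sup>2"
    by (intro power_mono) (simp_all add: V_diag_nonneg)
  then show ?thesis
    using quadratic_objective_le[OF U Q l, of "matpow A k *v x" q] unfolding fobj_at_state by linarith
qed

section \<open>The stopping index\<close>

text \<open>
  Adding \<open>1\<close> to the floor pushes \<open>k\<close> strictly beyond \<open>ln c / ln \<rho>\<close>; multiplying by the negative number
  \<open>ln \<rho>\<close> reverses the inequality.
\<close>
lemma power_le_if_log_lt:
  fixes \<rho> c :: real
  assumes \<rho>: "0 < \<rho>" "\<rho> < 1" and c: "0 < c" and k: "\<lfloor>ln c / ln \<rho>\<rfloor> + 1 \<le> int k"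
  shows "\<rho> ^ k \<le> c"
proof -
  have "ln c / ln \<rho> < real k" using k by linarith
  then have "ln (\<rho> ^ k) < ln c" using \<rho> by (simp add: ln_realpow field_simps)
  then show ?thesis using \<rho> c by simp
qed

lemma sqrt_shift_pos:
  fixes v V :: real
  assumes "0 < v" "0 \<le> V"
  shows "0 < sqrt (v + V\<^sup>2) - V"
  using real_less_rsqrt[of V "v + V\<^sup>2"] assms by simp

text \<open>
  The argument of the logarithm in \<^const>\<open>K_diag\<close> is the value \<open>c\<close> of \<open>\<rho>\<^sup>k\<close> at which the envelope equals
  \<open>v\<close>. If \<open>\<rho> = 0\<close>, the envelope already vanishes at \<open>k = 1\<close>, which is the value of \<^const>\<open>K_diag\<close> then.
\<close>
lemma K_diag_sound:
  fixes A Q :: "real ^ 'n ^ 'n" and U :: "complex ^ 'n ^ 'n" and X :: "(real ^ 'n) set" and q :: "real ^ 'n"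
  defines "\<rho> \<equiv> spec_radius (cmat A)" and "L \<equiv> sqrt (\<bar>lmaxU U Q\<bar> * muU U X)" and "V \<equiv> V_diag U Q q"
  assumes \<rho>: "0 \<le> \<rho>" "\<rho> < 1" and L: "0 < L" and v: "0 < v" and k: "K_diag U Q q A X v \<le> int k"
  shows "(L * \<rho> ^ k + V)\<^sup>2 - V\<^sup>2 \<le> v"
proof (cases "\<rho> = 0")
  case True
  then have "k \<noteq> 0" using k by (auto simp: K_diag_def \<rho>_def)
  then show ?thesis using True v by (simp add: power_0_left)
next
  case False
  have V: "0 \<le> V" by (simp add: V_def V_diag_nonneg)
  define c where "c = (sqrt (v + V\<^sup>2) - V) * inverse L"
  have "0 < c" using sqrt_shift_pos[OF v V] L by (simp add: c_def)
  moreover have "\<lfloor>ln c / ln \<rho>\<rfloor> + 1 \<le> int k"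
    using k False by (simp add: K_diag_def c_def \<rho>_def L_def V_def)
  ultimately have "\<rho> ^ k \<le> c" using \<rho> False by (intro power_le_if_log_lt) auto
  then have "L * \<rho> ^ k + V \<le> L * c + V" using L by simp
  also have "\<dots> = sqrt (v + V\<^sup>2)" using L by (simp add: c_def field_simps)
  finally have "(L * \<rho> ^ k + V)\<^sup>2 \<le> (sqrt (v + V\<^sup>2))\<^sup>2"
    using L \<rho> V by (intro power_mono) simp_all
  then show ?thesis using v by simp
qed

text \<open>
  A better value is undercut earlier by the decreasing envelope. This is what keeps the
  bound of the second loop from growing when it is recomputed.
\<close>
lemma K_diag_antimono:
  fixes A Q :: "real ^ 'n ^ 'n"
  assumes \<rho>: "0 \<le> spec_radius (cmat A)" "spec_radius (cmat A) < 1"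
    and L: "0 < sqrt (\<bar>lmaxU U Q\<bar> * muU U X)" and v: "0 < v" "v \<le> w"
  shows "K_diag U Q q A X w \<le> K_diag U Q q A X v"
proof (cases "spec_radius (cmat A) = 0")
  case True
  then show ?thesis by (simp add: K_diag_def)
next
  case False
  let ?V = "V_diag U Q q" and ?L = "sqrt (\<bar>lmaxU U Q\<bar> * muU U X)"
  let ?c = "\<lambda>u. (sqrt (u + ?V\<^sup>2) - ?V) * inverse ?L"
  have "0 < ?c v" using sqrt_shift_pos[OF v(1) V_diag_nonneg] L
    by (intro mult_pos_pos) simp_all
  moreover have "?c v \<le> ?c w" using v L by (intro mult_right_mono) simp_all
  ultimately have "ln (?c v) \<le> ln (?c w)" by (subst ln_le_cancel_iff) linarith+
  moreover have "ln (spec_radius (cmat A)) < 0" using \<rho> False by simp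
  ultimately have "ln (?c w) / ln (spec_radius (cmat A)) \<le> ln (?c v) / ln (spec_radius (cmat A))"
    by (simp add: divide_right_mono_neg)
  then show ?thesis using False by (simp add: K_diag_def floor_mono)
qed

section \<open>Correctness of the search\<close>

text \<open>
  The functions \<open>\<nu>\<close> and \<open>\<xi>\<close> stand for the oracle's values and maximizers. A positive value at an
  index up to \<open>N\<close> rules out both an exit by exhaustion and the answer \<^const>\<open>Failed\<close>.
\<close>
lemma first_positive_loop:
  fixes \<nu> :: "nat \<Rightarrow> real" and \<xi> :: "nat \<Rightarrow> 'x"
  assumes pos: "\<exists>k\<le>N. 0 < \<nu> k"
  obtains k where
    "while_option (\<lambda>(k, v, x). k < N \<and> v \<le> 0) (\<lambda>(k, v, x). (Suc k, \<nu> (Suc k), \<xi> (Suc k))) (0, \<nu> 0, \<xi> 0)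
      = Some (k, \<nu> k, \<xi> k)"
    "0 < \<nu> k" "\<And>i. i < k \<Longrightarrow> \<nu> i \<le> 0"
proof -
  let ?b = "\<lambda>(k, v, x). k < N \<and> v \<le> (0::real)"
  let ?c = "\<lambda>(k, v::real, x::'x). (Suc k, \<nu> (Suc k), \<xi> (Suc k))"
  define I where "I = (\<lambda>(k, v, x). v = \<nu> k \<and> x = \<xi> k \<and> k \<le> N \<and> (\<forall>i<k. \<nu> i \<le> 0))"
  have step: "I (?c s)" if "I s" "?b s" for s
    using that by (auto simp: I_def less_Suc_eq)
  have init: "I (0, \<nu> 0, \<xi> 0)" by (simp add: I_def)
  have "\<exists>t. while_option ?b ?c (0, \<nu> 0, \<xi> 0) = Some t"
  proof (rule measure_while_option_Some[where P = I and f = "\<lambda>(k, v, x). N - k", OF _ init])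
    show "I (?c s) \<and> (\<lambda>(k, v, x). N - k) (?c s) < (\<lambda>(k, v, x). N - k) s" if "I s" "?b s" for s
      using step[OF that] that(2) by (auto split: prod.splits)
  qed
  then obtain k v x where t: "while_option ?b ?c (0, \<nu> 0, \<xi> 0) = Some (k, v, x)" by auto
  have "I (k, v, x)" by (rule while_option_rule[where P = I, OF step t init])
  then have I: "v = \<nu> k" "x = \<xi> k" "k \<le> N" "\<And>i. i < k \<Longrightarrow> \<nu> i \<le> 0" by (auto simp: I_def)
  have "\<not> (k < N \<and> \<nu> k \<le> 0)" using while_option_stop[OF t] I(1) by simp
  moreover have "\<not> (k = N \<and> \<nu> k \<le> 0)" using pos I(4) by (metis le_neq_implies_less not_less)
  ultimately have "0 < \<nu> k" using I(3) by linarith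
  then show ?thesis using that t I by blast
qed

text \<open>
  The invariant is that the current optimum is positive, dominates all values seen so far, and
  that the bound is \<open>K\<close> of it. The values before \<open>k0\<close>, which this loop does not examine, are dominated
  because they are not positive. The distance from the index to the bound decreases since \<open>K\<close> is
  antitone, and on exit the soundness of \<open>K\<close> covers all remaining indices.
\<close>
lemma improvement_loop:
  fixes \<nu> :: "nat \<Rightarrow> real" and \<xi> :: "nat \<Rightarrow> 'x" and K :: "real \<Rightarrow> int"
  assumes anti: "\<And>v w. 0 < v \<Longrightarrow> v \<le> w \<Longrightarrow> K w \<le> K v"
    and sound: "\<And>v k. 0 < v \<Longrightarrow> K v \<le> int k \<Longrightarrow> \<nu> k \<le> v"
    and k0: "0 < \<nu> k0" "\<And>i. i < k0 \<Longrightarrow> \<nu> i \<le> 0"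
  obtains k k' where
    "while_option (\<lambda>(k, K', vopt, xopt, kopt). int k < K')
       (\<lambda>(k, K', vopt, xopt, kopt).
          if vopt < \<nu> (Suc k) then (Suc k, K (\<nu> (Suc k)), \<nu> (Suc k), \<xi> (Suc k), Suc k)
          else (Suc k, K', vopt, xopt, kopt))
       (k0, K (\<nu> k0), \<nu> k0, \<xi> k0, k0)
     = Some (k', K (\<nu> k), \<nu> k, \<xi> k, k)"
    "\<And>i. \<nu> i \<le> \<nu> k"
proof -
  let ?b = "\<lambda>(k, K', vopt, xopt, kopt). int k < K'"
  let ?c = "\<lambda>(k, K', vopt, xopt, kopt).
     if vopt < \<nu> (Suc k) then (Suc k, K (\<nu> (Suc k)), \<nu> (Suc k), \<xi> (Suc k), Suc k)
     else (Suc k, K', vopt, xopt, kopt)"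
  let ?s = "(k0, K (\<nu> k0), \<nu> k0, \<xi> k0, k0)"
  define I :: "nat \<times> int \<times> real \<times> 'x \<times> nat \<Rightarrow> bool" where
    "I = (\<lambda>(k, K', vopt, xopt, kopt). vopt = \<nu> kopt \<and> xopt = \<xi> kopt \<and> K' = K vopt
        \<and> 0 < vopt \<and> (\<forall>i\<le>k. \<nu> i \<le> vopt))"
  let ?m = "\<lambda>(k, K', vopt, xopt, kopt). nat (K' - int k)"
  have step: "I (?c s) \<and> ?m (?c s) < ?m s" if "I s" "?b s" for s
  proof -
    obtain k K' vopt xopt kopt where s: "s = (k, K', vopt, xopt, kopt)" by (cases s) auto
    have Is: "vopt = \<nu> kopt" "xopt = \<xi> kopt" "K' = K vopt" "0 < vopt"
        "\<And>i. i \<le> k \<Longrightarrow> \<nu> i \<le> vopt" and lt: "int k < K'"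
      using that by (auto simp: s I_def)
    show ?thesis
    proof (cases "vopt < \<nu> (Suc k)")
      case True
      then have "K (\<nu> (Suc k)) \<le> K'" using Is anti by simp
      moreover have "\<nu> i \<le> \<nu> (Suc k)" if "i \<le> Suc k" for i
        using that Is(5)[of i] True by (auto simp: le_Suc_eq)
      ultimately show ?thesis using True Is(4) lt by (simp add: s I_def)
    next
      case False
      then have "\<nu> i \<le> vopt" if "i \<le> Suc k" for i
        using that Is(5)[of i] by (auto simp: le_Suc_eq)
      then show ?thesis using False Is(1-4) lt by (simp add: s I_def)
    qed
  qed
  have "\<nu> i \<le> \<nu> k0" if "i \<le> k0" for i
    using that k0(1) k0(2)[of i] by (cases "i = k0") auto
  then have init: "I ?s" using k0(1) by (simp add: I_def)
  obtain t where "while_option ?b ?c ?s = Some t"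
    using measure_while_option_Some[where P = I and f = ?m, OF step init] by blast
  then obtain k' K' vopt xopt k where t: "while_option ?b ?c ?s = Some (k', K', vopt, xopt, k)"
    by (cases t) auto
  have "I (k', K', vopt, xopt, k)"
    by (rule while_option_rule[where P = I, OF step[THEN conjunct1] t init])
  then have I: "vopt = \<nu> k" "xopt = \<xi> k" "K' = K vopt" "0 < vopt"
      "\<And>i. i \<le> k' \<Longrightarrow> \<nu> i \<le> vopt" by (auto simp: I_def)
  have stop: "K' \<le> int k'" using while_option_stop[OF t] by simp
  have "\<nu> i \<le> \<nu> k" for i
  proof (cases "i \<le> k'")
    case True
    then show ?thesis using I by simp
  next
    case False
    then have "K vopt \<le> int i" using stop I(3) by linarith
    then show ?thesis using sound I(1,4) by blast
  qed
  then show ?thesis using that t I by blast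
qed

lemma algo_returns_maximum:
  assumes exact: "exact_oracle Q q A X solveQP"
    and init: "\<And>k. nu Q q A X k \<le> (sqrt (\<bar>lmaxU U Q\<bar> * muU U X) + V_diag U Q q)\<^sup>2 - (V_diag U Q q)\<^sup>2"
    and anti: "\<And>v w. 0 < v \<Longrightarrow> v \<le> w \<Longrightarrow> K_diag U Q q A X w \<le> K_diag U Q q A X v"
    and sound: "\<And>v k. 0 < v \<Longrightarrow> K_diag U Q q A X v \<le> int k \<Longrightarrow> nu Q q A X k \<le> v"
    and pos: "\<exists>k\<le>N. 0 < nu Q q A X k"
  obtains k where
    "algo solveQP U Q q A X N = Some (Returned (nu Q q A X k) (snd (solveQP (fobj Q q A k) X)) k)"
    "\<And>i. nu Q q A X i \<le> nu Q q A X k"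
proof -
  let ?\<nu> = "nu Q q A X" and ?K = "K_diag U Q q A X"
  define \<xi> where "\<xi> = (\<lambda>k. snd (solveQP (fobj Q q A k) X))"
  have solve: "solveQP (fobj Q q A k) X = (?\<nu> k, \<xi> k)" for k
    using exact by (simp add: exact_oracle_def \<xi>_def split_beta prod_eq_iff)
  let ?T = "(sqrt (\<bar>lmaxU U Q\<bar> * muU U X) + V_diag U Q q)\<^sup>2 - (V_diag U Q q)\<^sup>2"
  have algo: "algo solveQP U Q q A X N =
    (if ?T \<le> ?\<nu> 0 then Some (Returned (?\<nu> 0) (\<xi> 0) 0)
     else Option.bind
       (while_option (\<lambda>(k, v, x). k < N \<and> v \<le> 0) (\<lambda>(k, v, x). (Suc k, ?\<nu> (Suc k), \<xi> (Suc k)))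
         (0, ?\<nu> 0, \<xi> 0))
       (\<lambda>(k, v, x). if k = N \<and> v \<le> 0 then Some Failed
          else map_option (\<lambda>(k, K, vopt, xopt, kopt). Returned vopt xopt kopt)
            (while_option (\<lambda>(k, K', vopt, xopt, kopt). int k < K')
              (\<lambda>(k, K', vopt, xopt, kopt).
                if vopt < ?\<nu> (Suc k) then (Suc k, ?K (?\<nu> (Suc k)), ?\<nu> (Suc k), \<xi> (Suc k), Suc k)
                else (Suc k, K', vopt, xopt, kopt))
              (k, ?K v, v, x, k))))"
    by (simp only: algo_def Let_def solve prod.case)
  show ?thesis
  proof (cases "?T \<le> ?\<nu> 0")
    case True
    then have "algo solveQP U Q q A X N = Some (Returned (?\<nu> 0) (\<xi> 0) 0)" by (simp only: algo if_True)
    then show ?thesis using that[of 0] init True order_trans unfolding \<xi>_def by blast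
  next
    case False
    obtain k0 where k0: "while_option (\<lambda>(k, v, x). k < N \<and> v \<le> 0)
        (\<lambda>(k, v, x). (Suc k, ?\<nu> (Suc k), \<xi> (Suc k))) (0, ?\<nu> 0, \<xi> 0) = Some (k0, ?\<nu> k0, \<xi> k0)"
      and k0_pos: "0 < ?\<nu> k0" and k0_first: "\<And>i. i < k0 \<Longrightarrow> ?\<nu> i \<le> 0"
      using first_positive_loop[of N ?\<nu> \<xi>] pos by blast
    obtain k k' where k: "while_option (\<lambda>(k, K', vopt, xopt, kopt). int k < K')
       (\<lambda>(k, K', vopt, xopt, kopt).
          if vopt < ?\<nu> (Suc k) then (Suc k, ?K (?\<nu> (Suc k)), ?\<nu> (Suc k), \<xi> (Suc k), Suc k)
          else (Suc k, K', vopt, xopt, kopt))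
       (k0, ?K (?\<nu> k0), ?\<nu> k0, \<xi> k0, k0)
     = Some (k', ?K (?\<nu> k), ?\<nu> k, \<xi> k, k)"
      and max: "\<And>i. ?\<nu> i \<le> ?\<nu> k"
      using improvement_loop[of ?K ?\<nu> k0 \<xi>, OF anti sound k0_pos k0_first] by blast
    have "\<not> (k0 = N \<and> ?\<nu> k0 \<le> 0)" using k0_pos by simp
    with False have "algo solveQP U Q q A X N = Some (Returned (?\<nu> k) (\<xi> k) k)"
      by (simp only: algo k0 k if_False Option.bind.bind_lunit prod.case option.map)
    then show ?thesis using that max unfolding \<xi>_def by blast
  qed
qed

theorem theorem5:
  fixes X :: "(real ^ 'n) set" and A Q :: "real ^ 'n ^ 'n" and q :: "real ^ 'n"
    and U D :: "complex ^ 'n ^ 'n" and N :: nat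
    and solveQP :: "(real ^ 'n \<Rightarrow> real) \<Rightarrow> (real ^ 'n) set \<Rightarrow> real \<times> (real ^ 'n)"
  assumes "polytope X" and "X \<noteq> {}" and "X \<noteq> {0}"
    and "spec_radius (cmat A) < 1"
    and "invertible U" and "diagonal_matrix D" and "cmat A = U ** D ** matrix_inv U"
    and "transpose Q = Q" and "lambda_max (cmat Q) \<noteq> 0"
    and "pos_semidef Q \<or> neg_def Q"
    and "neg_def Q \<Longrightarrow> q \<noteq> 0"
    and "exact_oracle Q q A X solveQP"
    and "Inf (enat ` {k. nu Q q A X k > 0}) \<le> enat N"
  shows "\<exists>\<nu>opt xopt kopt.
           algo solveQP U Q q A X N = Some (Returned \<nu>opt xopt kopt)
           \<and> xopt \<in> X
           \<and> fobj Q q A kopt xopt = \<nu>opt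
           \<and> bdd_above (range (nu Q q A X))
           \<and> \<nu>opt = (SUP k. nu Q q A X k)"
proof -
  let ?\<rho> = "spec_radius (cmat A)" and ?V = "V_diag U Q q" and ?\<nu> = "nu Q q A X"
  let ?L = "sqrt (\<bar>lmaxU U Q\<bar> * muU U X)"
  have X: "compact X" using assms(1) by (rule polytope_imp_compact)
  have \<rho>: "0 \<le> ?\<rho>" by (rule diagonalizable_spec_radius(2)[OF assms(5-7)])
  have l: "lmaxU U Q \<noteq> 0" by (rule lmaxU_nonzero[OF assms(5,8-10)])
  have L: "0 < ?L" using l muU_bounds(2)[OF assms(5) X assms(2,3)] by simp
  have solution: "snd (solveQP (fobj Q q A k) X) \<in> X"
      "fobj Q q A k (snd (solveQP (fobj Q q A k) X)) = ?\<nu> k" for k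
    using assms(12) by (auto simp: exact_oracle_def split_beta)
  have decay: "?\<nu> k \<le> (?L * ?\<rho> ^ k + ?V)\<^sup>2 - ?V\<^sup>2" for k
    using fobj_le_geometric[OF X assms(2,3,5-8) l solution(1)] solution(2) by metis
  have init: "?\<nu> k \<le> (?L + ?V)\<^sup>2 - ?V\<^sup>2" for k
  proof -
    have "?\<rho> ^ k \<le> 1" using \<rho> assms(4) by (simp add: power_le_one)
    then have "?L * ?\<rho> ^ k + ?V \<le> ?L + ?V" using L by simp
    then have "(?L * ?\<rho> ^ k + ?V)\<^sup>2 \<le> (?L + ?V)\<^sup>2"
      using L \<rho> V_diag_nonneg[of U Q q] by (intro power_mono) simp_all
    then show ?thesis using decay[of k] by linarith
  qed
  have anti: "K_diag U Q q A X w \<le> K_diag U Q q A X v" if "0 < v" "v \<le> w" for v w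
    by (rule K_diag_antimono[OF \<rho> assms(4) L that])
  have sound: "?\<nu> k \<le> v" if "0 < v" "K_diag U Q q A X v \<le> int k" for v k
    using decay K_diag_sound[OF \<rho> assms(4) L that] by (rule order_trans)
  have pos: "\<exists>k\<le>N. 0 < ?\<nu> k"
  proof -
    let ?S = "enat ` {k. ?\<nu> k > 0}"
    have "?S \<noteq> {}"
    proof
      assume "?S = {}"
      then have "Inf ?S = \<infinity>" by (simp only: Inf_enat_def) simp
      then show False using assms(13) by simp
    qed
    then have "Inf ?S \<in> ?S" unfolding Inf_enat_def by (auto intro: LeastI)
    then show ?thesis using assms(13) by auto
  qed
  obtain k where k: "algo solveQP U Q q A X N
        = Some (Returned (?\<nu> k) (snd (solveQP (fobj Q q A k) X)) k)" "\<And>i. ?\<nu> i \<le> ?\<nu> k"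
    using algo_returns_maximum[OF assms(12) init anti sound pos] by blast
  have "(SUP i. ?\<nu> i) = ?\<nu> k" using k(2) by (intro cSup_eq_maximum) auto
  moreover have "bdd_above (range ?\<nu>)" using k(2) by (auto simp: bdd_above_def)
  ultimately show ?thesis using k(1) solution by metis
qed

end
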